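(* Let $\mathcal{H}=\mathcal{H}_M\oplus\mathcal{H}_K$ be a Hilbert space decomposed into an (orthogonal) direct sum of closed subspaces with orthogonal projections $P_M,P_K$, and let $\Phi=\{\phi_i\}_{i\in I}$ be a Parseval frame for $\mathcal{H}$ whose vectors all have the same norm, $\|\phi_i\|=c$ for all $i$. Let $x^0\in\mathcal{H}$, let $\beta>0$ be a thresholding parameter, and let $$\mathcal{T}=\{i:|\langle P_Kx^0,\phi_i\rangle|\ge\beta\},\qquad x^\star=\Phi\,\mathbb{1}_{\mathcal{T}}\Phi^\ast P_Kx^0 .$$ For $\delta>0$ assume that $x^0$ is $\delta$-clustered sparse in $\Phi$ with respect to $\mathcal{T}$, i.e. $\|\mathbb{1}_{\mathcal{T}^c}\Phi^\ast x^0\|_1\le\delta$. Then $$\|x^\star-x^0\|_2\le c\left[\delta+\|\mathbb{1}_{\mathcal{T}}\Phi^\ast P_Mx^0\|_1\right].$$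
   Context: A family $\{\phi_i\}_{i\in I}$ in a separable Hilbert space $\mathcal{H}$ is a Parseval frame if $\sum_{i}|\langle x,\phi_i\rangle|^2=\|x\|^2$ for all $x\in\mathcal{H}$. $\Phi^\ast x=(\langle x,\phi_i\rangle)_{i\in I}$ is the analysis operator and $\Phi((c_i)_i)=\sum_ic_i\phi_i$ the synthesis operator; $\mathbb{1}_{\mathcal{T}}$ restricts a sequence to $\mathcal{T}$ (zero elsewhere) and $\mathcal{T}^c=I\setminus\mathcal{T}$. $\|\cdot\|_2$ on $\mathcal{H}$ denotes the Hilbert space norm. *)

theory Defs
  imports "HOL-Analysis.Analysis"
begin

text \<open>
  Scalar fields of Hilbert spaces. Every element \<open>z\<close> of an instance is a root of the real polynomial
  \<open>X\<^sup>2 - (z + conj z) X + (norm z)\<^sup>2\<close>, so an instance is either the real or the complex numbers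
  with the usual conjugation; the class lets one statement cover both cases.
\<close>

class hilbert_scalar = real_normed_field +
  fixes conj :: "'a \<Rightarrow> 'a"
  assumes conj_add: "conj (a + b) = conj a + conj b"
    and conj_mult: "conj (a * b) = conj a * conj b"
    and mult_conj: "a * conj a = (norm a)\<^sup>2 *\<^sub>R 1"

instantiation real :: hilbert_scalar
begin
definition conj_real :: "real \<Rightarrow> real" where "conj_real x = x"
instance by standard (auto simp: conj_real_def power2_eq_square)
end

instantiation complex :: hilbert_scalar
begin
definition conj_complex :: "complex \<Rightarrow> complex" where "conj_complex z = cnj z"
instance by standard (auto simp: conj_complex_def scaleR_conv_of_real complex_norm_square simp del: of_real_power)
end

text \<open>
  Completeness and the norm come from the class \<open>banach\<close>; \<open>scale_of_real\<close> makes its real scalar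
  multiplication the restriction of \<open>scl\<close>, and \<open>ip_self\<close> makes its norm the one induced by \<open>ip\<close>.
  The inner product is linear in its first argument.
\<close>

locale hilbert_space = vector_space scl
  for scl :: "'k::hilbert_scalar \<Rightarrow> 'h::banach \<Rightarrow> 'h" +
  fixes ip :: "'h \<Rightarrow> 'h \<Rightarrow> 'k"
  assumes scale_of_real: "scl (of_real r) x = r *\<^sub>R x"
    and ip_add_left: "ip (x + y) z = ip x z + ip y z"
    and ip_scale_left: "ip (scl a x) y = a * ip x y"
    and ip_commute: "ip x y = conj (ip y x)"
    and ip_self: "ip x x = of_real ((norm x)\<^sup>2)"

definition orth_decomposition ::
    "('k::hilbert_scalar \<Rightarrow> 'h::banach \<Rightarrow> 'h) \<Rightarrow> ('h \<Rightarrow> 'h \<Rightarrow> 'k) \<Rightarrow> 'h set \<Rightarrow> 'h set \<Rightarrow> bool"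
  where "orth_decomposition scl ip M K \<longleftrightarrow>
    module.subspace scl M \<and> closed M \<and> module.subspace scl K \<and> closed K \<and>
    (\<forall>m\<in>M. \<forall>k\<in>K. ip m k = 0) \<and> (\<forall>x. \<exists>m\<in>M. \<exists>k\<in>K. x = m + k)"

definition orth_proj :: "('h::banach \<Rightarrow> 'h \<Rightarrow> 'k::hilbert_scalar) \<Rightarrow> 'h set \<Rightarrow> 'h \<Rightarrow> 'h"
  where "orth_proj ip M x = (THE y. y \<in> M \<and> (\<forall>z\<in>M. ip (x - y) z = 0))"

definition parseval_frame ::
    "('h::banach \<Rightarrow> 'h \<Rightarrow> 'k::hilbert_scalar) \<Rightarrow> 'i set \<Rightarrow> ('i \<Rightarrow> 'h) \<Rightarrow> bool"
  where "parseval_frame ip I \<phi> \<longleftrightarrow>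
    (\<forall>x. ((\<lambda>i. (norm (ip x (\<phi> i)))\<^sup>2) has_sum (norm x)\<^sup>2) I)"

definition analysis :: "('h \<Rightarrow> 'h \<Rightarrow> 'k) \<Rightarrow> ('i \<Rightarrow> 'h) \<Rightarrow> 'h \<Rightarrow> 'i \<Rightarrow> 'k"
  where "analysis ip \<phi> x = (\<lambda>i. ip x (\<phi> i))"

definition synthesis ::
    "('k \<Rightarrow> 'h::banach \<Rightarrow> 'h) \<Rightarrow> 'i set \<Rightarrow> ('i \<Rightarrow> 'h) \<Rightarrow> ('i \<Rightarrow> 'k) \<Rightarrow> 'h"
  where "synthesis scl I \<phi> c = (\<Sum>\<^sub>\<infinity>i\<in>I. scl (c i) (\<phi> i))"

definition restrict_seq :: "'i set \<Rightarrow> ('i \<Rightarrow> 'k::zero) \<Rightarrow> 'i \<Rightarrow> 'k"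
  where "restrict_seq T c = (\<lambda>i. if i \<in> T then c i else 0)"

text \<open>
  The \<open>\<ell>\<^sup>1\<close> norm takes values in \<^typ>\<open>ennreal\<close>, since a real-valued \<^const>\<open>infsum\<close> would be \<open>0\<close>
  on sequences that are not absolutely summable.
\<close>

definition l1_norm :: "'i set \<Rightarrow> ('i \<Rightarrow> 'k::real_normed_vector) \<Rightarrow> ennreal"
  where "l1_norm I c = (\<Sum>\<^sub>\<infinity>i\<in>I. ennreal (norm (c i)))"

definition clustered_sparse ::
    "('h \<Rightarrow> 'h \<Rightarrow> 'k::hilbert_scalar) \<Rightarrow> 'i set \<Rightarrow> ('i \<Rightarrow> 'h) \<Rightarrow> 'i set \<Rightarrow> real \<Rightarrow> 'h \<Rightarrow> bool"
  where "clustered_sparse ip I \<phi> T \<delta> x \<longleftrightarrow>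
    l1_norm I (restrict_seq (I - T) (analysis ip \<phi> x)) \<le> ennreal \<delta>"

lemma hilbert_space_real:
  "hilbert_space (scaleR :: real \<Rightarrow> 'h::{real_inner, banach} \<Rightarrow> 'h) inner"
  by unfold_locales
     (auto simp: algebra_simps inner_add_left conj_real_def inner_commute power2_norm_eq_inner)

lemma hilbert_space_complex:
  "hilbert_space ((*) :: complex \<Rightarrow> complex \<Rightarrow> complex) (\<lambda>z w. z * cnj w)"
  by unfold_locales
     (auto simp: algebra_simps conj_complex_def scaleR_conv_of_real complex_norm_square simp del: of_real_power)

context hilbert_space
begin

lemma ip_zero_self: "ip x x = 0 \<Longrightarrow> x = 0"
  by (simp add: ip_self)

lemma ip_diff_left: "ip (x - y) z = ip x z - ip y z"
  using ip_add_left[of "x - y" y z] by simp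

lemma orth_proj_eqI:
  assumes "subspace M" "y \<in> M" "\<And>z. z \<in> M \<Longrightarrow> ip (x - y) z = 0"
  shows "orth_proj ip M x = y"
  unfolding orth_proj_def
proof (rule the_equality)
  fix y' assume y': "y' \<in> M \<and> (\<forall>z\<in>M. ip (x - y') z = 0)"
  then have d: "y - y' \<in> M" using assms by (simp add: subspace_diff)
  have "ip (y - y') (y - y') = ip (x - y') (y - y') - ip (x - y) (y - y')"
    by (simp add: ip_diff_left)
  with d y' assms(3) have "ip (y - y') (y - y') = 0" by simp
  from ip_zero_self[OF this] show "y' = y" by simp
qed (use assms in auto)

end

end

theory Submission
  imports Defs
begin

text \<open>
  Why the theorem holds. Only finitely many frame coefficients of \<open>P\<^sub>K x\<^sub>0\<close> can have modulus at least
  \<open>\<beta>\<close>, because their squares are summable; hence \<open>x\<^sup>\<star>\<close> is a finite combination of frame vectors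
  (\<open>finite_large_coefficients\<close>, \<open>synthesis_restrict_finite\<close>). Since a Parseval frame reconstructs,
  \<open>x\<^sub>0\<close> is \<open>\<Sum>i. \<langle>x\<^sub>0, \<phi>\<^sub>i\<rangle> \<phi>\<^sub>i\<close>, so the error \<open>x\<^sup>\<star> - x\<^sub>0\<close> is synthesised from the coefficients
  \<open>\<langle>P\<^sub>K x\<^sub>0 - x\<^sub>0, \<phi>\<^sub>i\<rangle> = - \<langle>P\<^sub>M x\<^sub>0, \<phi>\<^sub>i\<rangle>\<close> on \<open>\<T>\<close> and \<open>- \<langle>x\<^sub>0, \<phi>\<^sub>i\<rangle>\<close> off \<open>\<T>\<close>. The triangle inequality
  with \<open>\<parallel>\<phi>\<^sub>i\<parallel> = c\<close> bounds its norm by \<open>c\<close> times the \<open>\<ell>\<^sup>1\<close> norm of that sequence, and the parts on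
  and off \<open>\<T>\<close> give the two summands on the right-hand side.

  The reconstruction formula is used in weak form only: the error is paired with itself, the
  polarised Parseval identity (\<open>parseval_polarised\<close>) expands this pairing as a sum over the frame,
  and each term is estimated by the Cauchy--Schwarz inequality. This is
  \<open>parseval_approximation_error\<close>. It avoids any discussion of norm convergence of the frame expansion,
  and bounding the finite partial sums yields the inequality in the extended nonnegative reals
  without distinguishing whether the \<open>\<ell>\<^sup>1\<close> norm is finite.
\<close>

section \<open>Conjugation and the Cauchy--Schwarz inequality\<close>

lemma conj_zero [simp]: "conj (0::'k::hilbert_scalar) = 0"
  using conj_add[of "0::'k" 0] by simp

lemma conj_diff: "conj (a - b) = conj a - conj (b::'k::hilbert_scalar)"
  using conj_add[of "a - b" b] by simp

lemma conj_sum: "conj (sum f A) = (\<Sum>i\<in>A. conj (f i :: 'k::hilbert_scalar))"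
  by (induction A rule: infinite_finite_induct) (auto simp: conj_add)

lemma conj_of_real [simp]: "conj (of_real r) = (of_real r :: 'k::hilbert_scalar)"
proof (cases "r = 0")
  case False
  have "of_real r * conj (of_real r) = (of_real r * of_real r :: 'k)"
    unfolding mult_conj by (simp add: of_real_def power2_eq_square)
  with False show ?thesis by simp
qed simp

lemma norm_conj [simp]: "norm (conj a) = norm (a::'k::hilbert_scalar)"
proof (cases "a = 0")
  case False
  have "norm a * norm (conj a) = (norm a)\<^sup>2"
    unfolding norm_mult[symmetric] mult_conj by simp
  with False show ?thesis by (simp add: power2_eq_square)
qed simp

context hilbert_space
begin

lemma ip_add_right: "ip x (y + z) = ip x y + ip x z"
  using ip_commute[of x "y + z"] ip_commute[of x y] ip_commute[of x z]
  by (simp add: ip_add_left conj_add)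

lemma ip_zero_left [simp]: "ip 0 y = 0"
  using ip_add_left[of 0 0 y] by simp

lemma ip_sum_left: "ip (sum f F) y = (\<Sum>i\<in>F. ip (f i) y)"
  by (induction F rule: infinite_finite_induct) (auto simp: ip_add_left)

lemma norm_ip_squared: "of_real ((norm (ip x y))\<^sup>2) = ip x y * ip y x"
  using mult_conj[of "ip x y"] ip_commute[of y x] by (simp add: of_real_def)

text \<open>
  The vector \<open>z = \<parallel>y\<parallel>\<^sup>2 x - \<langle>x, y\<rangle> y\<close> is orthogonal to \<open>y\<close>, and
  \<open>0 \<le> \<langle>z, z\<rangle> = \<parallel>y\<parallel>\<^sup>2 (\<parallel>x\<parallel>\<^sup>2 \<parallel>y\<parallel>\<^sup>2 - |\<langle>x, y\<rangle>|\<^sup>2)\<close>.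
\<close>

lemma Cauchy_Schwarz_ip: "norm (ip x y) \<le> norm x * norm y"
proof (cases "y = 0")
  case True
  then show ?thesis using ip_commute[of x y] by simp
next
  case False
  define r where "r = (norm y)\<^sup>2"
  define q where "q = r * (norm x)\<^sup>2 - (norm (ip x y))\<^sup>2"
  define z where "z = scl (of_real r) x - scl (ip x y) y"
  have r: "r > 0" using False by (simp add: r_def)
  have "ip z y = 0"
    by (simp add: z_def ip_diff_left ip_scale_left ip_self r_def)
  then have yz: "ip y z = 0"
    using ip_commute[of y z] by simp
  have "ip z x = of_real r * ip x x - ip x y * ip y x"
    by (simp add: z_def ip_diff_left ip_scale_left)
  also have "\<dots> = of_real q"
    by (simp only: q_def ip_self of_real_diff of_real_mult norm_ip_squared)
  finally have xz: "ip x z = of_real q"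
    using ip_commute[of x z] by simp
  have "ip z z = of_real r * ip x z - ip x y * ip y z"
    by (subst (1) z_def) (simp only: ip_diff_left ip_scale_left)
  then have "of_real ((norm z)\<^sup>2) = (of_real (r * q) :: 'k)"
    unfolding ip_self xz yz by simp
  then have "r * q \<ge> 0"
    by (metis of_real_eq_iff zero_le_power2)
  then have "(norm (ip x y))\<^sup>2 \<le> (norm x * norm y)\<^sup>2"
    using r by (simp add: q_def r_def zero_le_mult_iff power_mult_distrib mult.commute)
  then show ?thesis
    by (rule power2_le_imp_le) simp
qed

end

section \<open>Parseval frames\<close>

lemma has_sum_minus:
  fixes f g :: "'i \<Rightarrow> 'b::topological_ab_group_add"
  assumes "(f has_sum a) I" and "(g has_sum b) I"
  shows "((\<lambda>i. f i - g i) has_sum (a - b)) I"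
  using has_sum_add[OF assms(1), of "\<lambda>i. - g i" "- b"] assms(2) by (simp add: has_sum_uminus)

context hilbert_space
begin

text \<open>
  This is polarisation, obtained by comparing the Parseval identities of \<open>x + y\<close>, \<open>x\<close> and \<open>y\<close>. Only
  the symmetrised inner product, twice its real part, is expanded: it needs no imaginary
  unit, so the argument is the same for real and complex scalars.
\<close>

lemma parseval_polarised:
  assumes "parseval_frame ip I \<phi>"
  shows "((\<lambda>i. ip x (\<phi> i) * ip (\<phi> i) y + ip y (\<phi> i) * ip (\<phi> i) x) has_sum (ip x y + ip y x)) I"
proof -
  have P: "((\<lambda>i. ip u (\<phi> i) * ip (\<phi> i) u) has_sum ip u u) I" for u
  proof -
    have "((\<lambda>i. (norm (ip u (\<phi> i)))\<^sup>2) has_sum (norm u)\<^sup>2) I"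
      using assms by (simp add: parseval_frame_def)
    from has_sum_of_real[OF this, where 'a = 'k] show ?thesis
      by (simp only: norm_ip_squared ip_self)
  qed
  show ?thesis
    using has_sum_minus[OF has_sum_minus[OF P[of "x + y"] P[of x]] P[of y]]
    by (simp add: ip_add_left ip_add_right algebra_simps)
qed

text \<open>
  Each such coefficient contributes at least \<open>\<beta>\<^sup>2\<close> to the Parseval sum \<open>\<parallel>x\<parallel>\<^sup>2\<close>, so there are at most
  \<open>\<parallel>x\<parallel>\<^sup>2 / \<beta>\<^sup>2\<close> of them.
\<close>

lemma finite_large_coefficients:
  assumes "parseval_frame ip I \<phi>" and "\<beta> > 0"
  shows "finite {i \<in> I. norm (ip x (\<phi> i)) \<ge> \<beta>}"
proof (rule finite_if_finite_subsets_card_bdd[THEN conjunct1])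
  fix F assume F: "F \<subseteq> {i \<in> I. norm (ip x (\<phi> i)) \<ge> \<beta>}" "finite F"
  have "of_nat (card F) * \<beta>\<^sup>2 \<le> (\<Sum>i\<in>F. (norm (ip x (\<phi> i)))\<^sup>2)"
    using F \<open>\<beta> > 0\<close> by (intro sum_bounded_below power_mono) auto
  also have "\<dots> \<le> (norm x)\<^sup>2"
    using assms(1) F by (intro finite_sum_le_has_sum[where A = I]) (auto simp: parseval_frame_def)
  finally have "real (card F) \<le> (norm x)\<^sup>2 / \<beta>\<^sup>2"
    using \<open>\<beta> > 0\<close> by (simp add: field_simps)
  then show "card F \<le> nat \<lfloor>(norm x)\<^sup>2 / \<beta>\<^sup>2\<rfloor>"
    by (simp add: le_nat_floor)
qed

lemma synthesis_restrict_finite: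
  assumes "finite T" and "T \<subseteq> I"
  shows "synthesis scl I \<phi> (restrict_seq T a) = (\<Sum>i\<in>T. scl (a i) (\<phi> i))"
proof -
  have "synthesis scl I \<phi> (restrict_seq T a) = (\<Sum>\<^sub>\<infinity>i\<in>T. scl (a i) (\<phi> i))"
    unfolding synthesis_def restrict_seq_def
    using assms by (intro infsum_cong_neutral) auto
  with assms show ?thesis by simp
qed

text \<open>
  This is the weak form of reconstruction followed by the triangle inequality. The vector
  \<open>d = (\<Sum>i\<in>T. a\<^sub>i \<phi>\<^sub>i) - x\<close> should be \<open>\<Sum>i. g\<^sub>i \<phi>\<^sub>i\<close>, where \<open>g\<close> is the difference of the two
  coefficient sequences. Pairing with \<open>d\<close> itself, \<open>2 \<parallel>d\<parallel>\<^sup>2\<close> is the frame sum of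
  \<open>g\<^sub>i \<langle>\<phi>\<^sub>i, d\<rangle> + \<langle>d, \<phi>\<^sub>i\<rangle> conj g\<^sub>i\<close>; by the Cauchy--Schwarz inequality its partial sums are bounded by
  \<open>2 \<parallel>d\<parallel> c\<close> times the \<open>\<ell>\<^sup>1\<close> norm of \<open>g\<close>, and a factor \<open>2 \<parallel>d\<parallel>\<close> cancels.
\<close>

lemma parseval_approximation_error:
  assumes "parseval_frame ip I \<phi>"
    and bound: "\<And>i. i \<in> I \<Longrightarrow> norm (\<phi> i) \<le> c"
    and T: "finite T" "T \<subseteq> I"
  shows "ennreal (norm ((\<Sum>i\<in>T. scl (a i) (\<phi> i)) - x))
    \<le> ennreal c * l1_norm I (\<lambda>i. restrict_seq T a i - analysis ip \<phi> x i)"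
proof -
  define s where "s = (\<Sum>i\<in>T. scl (a i) (\<phi> i))"
  define d where "d = s - x"
  define g where "g i = restrict_seq T a i - ip x (\<phi> i)" for i
  define h where "h i = g i * ip (\<phi> i) d + ip d (\<phi> i) * conj (g i)" for i
  \<comment> \<open>The polarised identity expands \<open>x\<close>; the finite combination \<open>s\<close> expands by linearity alone.\<close>
  have "((\<lambda>i. restrict_seq T a i * ip (\<phi> i) d + ip d (\<phi> i) * conj (restrict_seq T a i))
      has_sum (ip s d + ip d s)) I"
  proof (rule has_sum_finite_neutralI[OF T])
    have "ip s d = (\<Sum>i\<in>T. a i * ip (\<phi> i) d)"
      by (simp add: s_def ip_sum_left ip_scale_left)
    moreover have "ip d s = (\<Sum>i\<in>T. ip d (\<phi> i) * conj (a i))"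
      using ip_commute[of d s] ip_commute[of d "\<phi> _"]
      by (simp add: \<open>ip s d = _\<close> conj_sum conj_mult mult.commute)
    ultimately show "ip s d + ip d s =
        (\<Sum>i\<in>T. restrict_seq T a i * ip (\<phi> i) d + ip d (\<phi> i) * conj (restrict_seq T a i))"
      by (simp add: restrict_seq_def sum.distrib)
  qed (auto simp: restrict_seq_def)
  from has_sum_minus[OF this parseval_polarised[OF assms(1), of x d]]
  have "(h has_sum (ip s d + ip d s - (ip x d + ip d x))) I"
    by (rule back_subst[where P = "\<lambda>f. (f has_sum _) I"])
       (auto simp: h_def g_def conj_diff algebra_simps ip_commute[of "\<phi> _" x] fun_eq_iff)
  moreover have "ip s d + ip d s - (ip x d + ip d x) = of_real (2 * (norm d)\<^sup>2)"
  proof -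
    have "ip d s - ip d x = ip d d"
      using ip_add_right[of d x d] by (simp add: d_def)
    moreover have "ip s d - ip x d = ip d d"
      unfolding ip_diff_left[symmetric] by (simp add: d_def)
    ultimately have "ip s d + ip d s - (ip x d + ip d x) = ip d d + ip d d"
      by (metis add_diff_add)
    then show ?thesis by (simp add: ip_self)
  qed
  ultimately have "(h has_sum of_real (2 * (norm d)\<^sup>2)) I" by simp
  then have lim: "((\<lambda>F. ennreal (norm (sum h F))) \<longlongrightarrow> ennreal (norm (of_real (2 * (norm d)\<^sup>2) :: 'k)))
      (finite_subsets_at_top I)"
    unfolding has_sum_def by (intro tendsto_ennrealI tendsto_norm)
  have "ennreal (norm (of_real (2 * (norm d)\<^sup>2) :: 'k)) \<le> ennreal (2 * norm d) * (ennreal c * l1_norm I g)"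
  proof (rule tendsto_upperbound[OF lim])
    have "ennreal (norm (sum h F)) \<le> ennreal (2 * norm d) * (ennreal c * l1_norm I g)"
      if F: "finite F" "F \<subseteq> I" for F
    proof -
      have "norm (h i) \<le> 2 * norm d * (c * norm (g i))" if "i \<in> F" for i
      proof -
        have "norm (ip d (\<phi> i)) \<le> norm d * c"
          using Cauchy_Schwarz_ip[of d "\<phi> i"] bound[of i] that F
          by (meson mult_left_mono norm_ge_zero order_trans subsetD)
        then have "norm (g i) * norm (ip d (\<phi> i)) \<le> norm (g i) * (norm d * c)"
          by (intro mult_left_mono) auto
        moreover have "norm (h i) \<le> 2 * (norm (g i) * norm (ip d (\<phi> i)))"
          unfolding h_def ip_commute[of "\<phi> i" d]
          by (rule norm_triangle_le) (simp add: norm_mult)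
        ultimately show ?thesis by (simp add: algebra_simps)
      qed
      then have "norm (sum h F) \<le> (\<Sum>i\<in>F. 2 * norm d * (c * norm (g i)))"
        by (intro sum_norm_le) auto
      then have "ennreal (norm (sum h F)) \<le> ennreal (2 * norm d * (c * (\<Sum>i\<in>F. norm (g i))))"
        by (intro ennreal_leI) (simp add: sum_distrib_left)
      \<comment> \<open>For empty \<open>I\<close> the bound \<open>c\<close> may be negative; \<open>ennreal\<close> then truncates both sides to \<open>0\<close>.\<close>
      also have "\<dots> = ennreal (2 * norm d) * (ennreal c * ennreal (\<Sum>i\<in>F. norm (g i)))"
        by (simp add: ennreal_mult' ennreal_mult'' sum_nonneg)
      also have "ennreal (\<Sum>i\<in>F. norm (g i)) = (\<Sum>i\<in>F. ennreal (norm (g i)))"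
        by (simp add: sum_ennreal)
      also have "\<dots> = (\<Sum>\<^sub>\<infinity>i\<in>F. ennreal (norm (g i)))"
        using F by simp
      also have "\<dots> \<le> l1_norm I g"
        unfolding l1_norm_def using F by (intro infsum_mono_neutral nonneg_summable_on_complete) auto
      finally show ?thesis by (simp add: mult_left_mono)
    qed
    then show "\<forall>\<^sub>F F in finite_subsets_at_top I.
        ennreal (norm (sum h F)) \<le> ennreal (2 * norm d) * (ennreal c * l1_norm I g)"
      by (intro eventually_finite_subsets_at_top_weakI) auto
  qed simp
  moreover have "ennreal (norm (of_real (2 * (norm d)\<^sup>2) :: 'k)) = ennreal (2 * norm d) * ennreal (norm d)"
    by (simp add: ennreal_mult'' power2_eq_square norm_mult mult.assoc)
  ultimately have "ennreal (norm d) \<le> ennreal c * l1_norm I g"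
    by (cases "d = 0") (auto simp: ennreal_mult_le_mult_iff)
  then show ?thesis
    by (simp add: d_def s_def g_def[abs_def] analysis_def)
qed

section \<open>Thresholding in an orthogonally decomposed space\<close>

lemma orth_decomposition_sum:
  assumes "orth_decomposition scl ip M K"
  shows "orth_proj ip M x + orth_proj ip K x = x"
proof -
  obtain m k where mk: "m \<in> M" "k \<in> K" "x = m + k"
    using assms unfolding orth_decomposition_def by metis
  have orth: "ip u v = 0" "ip v u = 0" if "u \<in> M" "v \<in> K" for u v
    using assms that ip_commute[of v u] by (auto simp: orth_decomposition_def)
  have "subspace M" "subspace K"
    using assms by (auto simp: orth_decomposition_def)
  then have "orth_proj ip M x = m" "orth_proj ip K x = k"
    using mk orth by (auto intro!: orth_proj_eqI)
  with mk show ?thesis by simp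
qed

end

lemma l1_norm_restrict_split:
  "l1_norm I c = l1_norm I (restrict_seq (I - T) c) + l1_norm I (restrict_seq T c)"
  unfolding l1_norm_def restrict_seq_def
  by (subst infsum_add[symmetric]) (auto intro!: infsum_cong nonneg_summable_on_complete)

theorem proposition2p9:
  fixes scl :: "'k::hilbert_scalar \<Rightarrow> 'h::banach \<Rightarrow> 'h"
    and ip :: "'h \<Rightarrow> 'h \<Rightarrow> 'k"
    and H\<^sub>M H\<^sub>K :: "'h set"
    and I \<T> :: "'i set"
    and \<phi> :: "'i \<Rightarrow> 'h"
    and c \<beta> \<delta> :: real
    and x\<^sub>0 x_star :: 'h
  assumes "hilbert_space scl ip"
    and "separable_space (euclidean :: 'h topology)"
    and "orth_decomposition scl ip H\<^sub>M H\<^sub>K"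
    and "parseval_frame ip I \<phi>"
    and "\<And>i. i \<in> I \<Longrightarrow> norm (\<phi> i) = c"
    and "\<beta> > 0"
    and "\<T> = {i \<in> I. norm (ip (orth_proj ip H\<^sub>K x\<^sub>0) (\<phi> i)) \<ge> \<beta>}"
    and "x_star = synthesis scl I \<phi> (restrict_seq \<T> (analysis ip \<phi> (orth_proj ip H\<^sub>K x\<^sub>0)))"
    and "\<delta> > 0"
    and "clustered_sparse ip I \<phi> \<T> \<delta> x\<^sub>0"
  shows "ennreal (norm (x_star - x\<^sub>0))
    \<le> ennreal c * (ennreal \<delta> + l1_norm I (restrict_seq \<T> (analysis ip \<phi> (orth_proj ip H\<^sub>M x\<^sub>0))))"
proof -
  interpret hilbert_space scl ip by fact
  define a where "a = analysis ip \<phi> (orth_proj ip H\<^sub>K x\<^sub>0)"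
  define g where "g i = restrict_seq \<T> a i - analysis ip \<phi> x\<^sub>0 i" for i
  have T: "finite \<T>" "\<T> \<subseteq> I"
    using assms(4,6,7) finite_large_coefficients by auto
  have "x_star = (\<Sum>i\<in>\<T>. scl (a i) (\<phi> i))"
    using assms(8) T by (simp add: synthesis_restrict_finite a_def)
  then have "ennreal (norm (x_star - x\<^sub>0)) \<le> ennreal c * l1_norm I g"
    using parseval_approximation_error[OF assms(4) _ T, of c a x\<^sub>0] assms(5)
    by (simp add: g_def[abs_def])
  also have "l1_norm I g =
      l1_norm I (restrict_seq (I - \<T>) (analysis ip \<phi> x\<^sub>0))
      + l1_norm I (restrict_seq \<T> (analysis ip \<phi> (orth_proj ip H\<^sub>M x\<^sub>0)))"
  proof -
    have "ip x\<^sub>0 (\<phi> i) = ip (orth_proj ip H\<^sub>M x\<^sub>0) (\<phi> i) + ip (orth_proj ip H\<^sub>K x\<^sub>0) (\<phi> i)" for i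
      unfolding ip_add_left[symmetric] orth_decomposition_sum[OF assms(3)] ..
    then have coeff: "ip (orth_proj ip H\<^sub>K x\<^sub>0) (\<phi> i) - ip x\<^sub>0 (\<phi> i) = - ip (orth_proj ip H\<^sub>M x\<^sub>0) (\<phi> i)" for i
      by simp
    \<comment> \<open>On \<open>\<T>\<close> the error consists of the coefficients of \<open>P\<^sub>K x\<^sub>0 - x\<^sub>0 = - P\<^sub>M x\<^sub>0\<close>, off \<open>\<T>\<close> of those of \<open>- x\<^sub>0\<close>.\<close>
    have
      "norm (restrict_seq (I - \<T>) g i) = norm (restrict_seq (I - \<T>) (analysis ip \<phi> x\<^sub>0) i)"
      "norm (restrict_seq \<T> g i) = norm (restrict_seq \<T> (analysis ip \<phi> (orth_proj ip H\<^sub>M x\<^sub>0)) i)" for i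
      by (simp_all add: g_def a_def restrict_seq_def analysis_def coeff)
    then show ?thesis
      by (subst l1_norm_restrict_split[where T = \<T>]) (simp add: l1_norm_def)
  qed
  also have "\<dots> \<le> ennreal \<delta> + l1_norm I (restrict_seq \<T> (analysis ip \<phi> (orth_proj ip H\<^sub>M x\<^sub>0)))"
    using assms(10) by (intro add_right_mono) (simp add: clustered_sparse_def)
  finally show ?thesis by (simp add: mult_left_mono)
qed

end
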